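(* Let $X$ be an infinite locally compact Hausdorff space admitting a countable basis $\mathcal B$ of compact open sets closed under finite intersections, and let $W_0$ be the space of finite and infinite words in $X$. The topology of generalized cylinders on $W_0$ coincides with the quotient topology induced by the surjective map $Q:A\to W_0$, where $A=X_\infty\times X_\infty\times\cdots$.
   Context: $\mathbb N=\{1,2,\dots\}$. $W_0=X^{\mathbb N}\cup\bigcup_{n\ge0}X^n$ with $X^0=\{\vec 0\}$ (empty word); elements are words $x=x_1x_2\cdots$ with length $\ell(x)\in\{0,1,2,\dots\}\cup\{\infty\}$. $X_\infty=X\cup\{\infty\}$ is the one-point compactification of $X$ and $A=X_\infty^{\mathbb N}$ has the product topology. $Q:A\to W_0$ sends $(x_1,x_2,\dots)$ to the infinite word $x_1x_2\cdots$ if all $x_i\ne\infty$; to $x_1\cdots x_n$ if $x_{n+1}=\infty$ and $x_i\neq\infty$ for $1\le i\le n$; and to $\vec 0$ if $x_1=\infty$. Generalized cylinders: for $k\in\mathbb N$, $B_1,\dots,B_k\in\mathcal B$ and $K\subseteq X$ compact open, $Z[B_1\times\cdots\times B_k,K]=\{x\in W_0:\ell(x)\ge k,\ x_i\in B_i\ (1\le i\le k),\ x_{k+1}\notin K\}$ (the last condition being vacuous if $\ell(x)=k$) and $C[K]=\{x\in W_0:x=\vec 0\text{ or }x_1\notin K\}$. The topology of generalized cylinders on $W_0$ is the topology generated by all these sets. *)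

theory Defs
  imports "HOL-Analysis.Analysis"
begin

text \<open>
  Letters of words and coordinates of sequences are numbered from 0, so the index
  \<open>i\<close> here is the index \<open>i + 1\<close> of the usual notation $x = x_1 x_2 \cdots$. The length
  \<open>k\<close> of a prefix is unaffected.
\<close>

datatype 'a fi_word = Fin_Word "'a list" | Inf_Word "nat \<Rightarrow> 'a"

fun wlength :: "'a fi_word \<Rightarrow> enat" where
  "wlength (Fin_Word xs) = enat (length xs)"
| "wlength (Inf_Word f) = \<infinity>"

text \<open>Only meaningful for positions \<open>i\<close> with \<open>enat i < wlength w\<close>.\<close>

fun letter :: "'a fi_word \<Rightarrow> nat \<Rightarrow> 'a" where
  "letter (Fin_Word xs) i = xs ! i"
| "letter (Inf_Word f) i = f i"

definition words :: "'a topology \<Rightarrow> 'a fi_word set" where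
  "words X = Fin_Word ` {xs. set xs \<subseteq> topspace X} \<union> Inf_Word ` {f. range f \<subseteq> topspace X}"

text \<open>
  The point at infinity of \<^const>\<open>Alexandroff_compactification\<close> is \<^const>\<open>None\<close>; it is an
  isolated point when \<open>X\<close> is itself compact.
\<close>

definition alphabet_sequences :: "'a topology \<Rightarrow> (nat \<Rightarrow> 'a option) topology" where
  "alphabet_sequences X = product_topology (\<lambda>_. Alexandroff_compactification X) UNIV"

definition word_of_seq :: "(nat \<Rightarrow> 'a option) \<Rightarrow> 'a fi_word" where
  "word_of_seq a =
     (if \<forall>i. a i \<noteq> None then Inf_Word (\<lambda>i. the (a i))
      else Fin_Word (map (\<lambda>i. the (a i)) [0..<LEAST n. a n = None]))"

text \<open>
  The set $Z[B_1 \times \cdots \times B_k, K]$, where \<open>Bs\<close> is the list of the $B_i$.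
\<close>

definition cylinder :: "'a topology \<Rightarrow> 'a set list \<Rightarrow> 'a set \<Rightarrow> 'a fi_word set" where
  "cylinder X Bs K =
     {w \<in> words X. enat (length Bs) \<le> wlength w \<and>
        (\<forall>i < length Bs. letter w i \<in> Bs ! i) \<and>
        (enat (length Bs) < wlength w \<longrightarrow> letter w (length Bs) \<notin> K)}"

definition empty_cylinder :: "'a topology \<Rightarrow> 'a set \<Rightarrow> 'a fi_word set" where
  "empty_cylinder X K = {w \<in> words X. w = Fin_Word [] \<or> letter w 0 \<notin> K}"

definition generalized_cylinders :: "'a topology \<Rightarrow> 'a set set \<Rightarrow> 'a fi_word set set" where
  "generalized_cylinders X \<B> =
     {cylinder X Bs K | Bs K. Bs \<noteq> [] \<and> set Bs \<subseteq> \<B> \<and> compactin X K \<and> openin X K} \<union>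
     {empty_cylinder X K | K. compactin X K \<and> openin X K}"

definition generalized_cylinder_topology :: "'a topology \<Rightarrow> 'a set set \<Rightarrow> 'a fi_word topology"
  where "generalized_cylinder_topology X \<B> = topology_generated_by (generalized_cylinders X \<B>)"

text \<open>The quotient topology on the image of \<open>f\<close>.\<close>

definition quotient_topology :: "'a topology \<Rightarrow> ('a \<Rightarrow> 'b) \<Rightarrow> 'b topology" where
  "quotient_topology T f =
     topology (\<lambda>U. U \<subseteq> f ` topspace T \<and> openin T {x \<in> topspace T. f x \<in> U})"

lemma openin_quotient_topology:
  "openin (quotient_topology T f) U \<longleftrightarrow>
     U \<subseteq> f ` topspace T \<and> openin T {x \<in> topspace T. f x \<in> U}"
proof -
  have "istopology (\<lambda>U. U \<subseteq> f ` topspace T \<and> openin T {x \<in> topspace T. f x \<in> U})"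
    unfolding istopology_def
  proof (intro conjI allI impI)
    fix S S'
    assume "S \<subseteq> f ` topspace T \<and> openin T {x \<in> topspace T. f x \<in> S}"
      and "S' \<subseteq> f ` topspace T \<and> openin T {x \<in> topspace T. f x \<in> S'}"
    moreover have "{x \<in> topspace T. f x \<in> S \<inter> S'} =
        {x \<in> topspace T. f x \<in> S} \<inter> {x \<in> topspace T. f x \<in> S'}"
      by blast
    ultimately show "S \<inter> S' \<subseteq> f ` topspace T" "openin T {x \<in> topspace T. f x \<in> S \<inter> S'}"
      by auto
  next
    fix \<K>
    assume *: "\<forall>K\<in>\<K>. K \<subseteq> f ` topspace T \<and> openin T {x \<in> topspace T. f x \<in> K}"
    then show "\<Union>\<K> \<subseteq> f ` topspace T"
      by blast
    have "{x \<in> topspace T. f x \<in> \<Union>\<K>} = (\<Union>K\<in>\<K>. {x \<in> topspace T. f x \<in> K})"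
      by blast
    then show "openin T {x \<in> topspace T. f x \<in> \<Union>\<K>}"
      using * by auto
  qed
  then show ?thesis
    by (simp add: quotient_topology_def)
qed

lemma topspace_quotient_topology: "topspace (quotient_topology T f) = f ` topspace T"
proof
  show "topspace (quotient_topology T f) \<subseteq> f ` topspace T"
    using openin_topspace[of "quotient_topology T f"] unfolding openin_quotient_topology
    by (rule conjunct1)
  have "{x \<in> topspace T. f x \<in> f ` topspace T} = topspace T"
    by blast
  then have "openin (quotient_topology T f) (f ` topspace T)"
    by (simp add: openin_quotient_topology)
  then show "f ` topspace T \<subseteq> topspace (quotient_topology T f)"
    by (rule openin_subset)
qed

lemma quotient_map_quotient_topology: "quotient_map T (quotient_topology T f) f"
  by (simp add: quotient_map_def topspace_quotient_topology openin_quotient_topology)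

end

theory Submission
  imports Defs
begin

text \<open>
  Generalized cylinders pull back to open sets because a compact open \<open>K\<close> is closed in the
  compactification. Conversely, let the preimage \<open>W\<close> of \<open>U\<close> be open and let \<open>w \<in> U\<close>. If \<open>w\<close> is
  infinite, a basic open box in \<open>W\<close> around its only preimage gives a cylinder with \<open>K = {}\<close>. If \<open>w\<close>
  has length \<open>n\<close>, then \<open>W\<close> contains the compact fibre of all sequences that agree with \<open>w\<close> up to
  the first \<open>\<infinity>\<close>, so by a tube argument it contains an open set that restricts only the first
  \<open>n + 1\<close> coordinates; the last restriction is a neighbourhood of \<open>\<infinity>\<close>, and enlarging its compact
  complement to a compact open \<open>K\<close> gives the cylinder.
\<close>

section \<open>Words read off from sequences\<close>

lemma word_of_seq_infinite:
  assumes "\<And>i. a i \<noteq> None"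
  shows "word_of_seq a = Inf_Word (\<lambda>i. the (a i))"
  using assms by (simp add: word_of_seq_def)

lemma word_of_seq_finite:
  assumes "\<And>i. i < n \<Longrightarrow> a i \<noteq> None" and "a n = None"
  shows "word_of_seq a = Fin_Word (map (\<lambda>i. the (a i)) [0..<n])"
proof -
  have "(LEAST n. a n = None) = n"
    using assms by (intro Least_equality) (auto simp del: not_None_eq intro: leI)
  then show ?thesis
    using assms by (auto simp: word_of_seq_def)
qed

text \<open>\<open>word_of_seq\<close> ignores everything after the first \<open>None\<close>, so
  this split is the one along which it can be computed.\<close>

lemma sequence_cases:
  fixes a :: "nat \<Rightarrow> 'a option"
  obtains (infinite) "\<And>i. a i \<noteq> None"
  | (finite) n where "\<And>i. i < n \<Longrightarrow> a i \<noteq> None" "a n = None"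
proof (cases "\<exists>n. a n = None")
  case True
  define n where "n = (LEAST n. a n = None)"
  have "a n = None" "\<And>i. i < n \<Longrightarrow> a i \<noteq> None"
    using LeastI_ex[of "\<lambda>n. a n = None"] True not_less_Least unfolding n_def by auto
  then show thesis
    using finite by blast
next
  case False
  then show thesis
    by (intro infinite) simp
qed

lemma wlength_word_of_seq: "enat n \<le> wlength (word_of_seq a) \<longleftrightarrow> (\<forall>i<n. a i \<noteq> None)"
proof (cases a rule: sequence_cases)
  case infinite
  then show ?thesis
    by (simp add: word_of_seq_infinite)
next
  case (finite m)
  then have "n \<le> m \<longleftrightarrow> (\<forall>i<n. a i \<noteq> None)"
    by (meson leI less_le_trans)
  moreover have "word_of_seq a = Fin_Word (map (\<lambda>i. the (a i)) [0..<m])"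
    by (rule word_of_seq_finite) fact+
  ultimately show ?thesis
    by simp
qed

lemma wlength_word_of_seq_less: "enat n < wlength (word_of_seq a) \<longleftrightarrow> (\<forall>i\<le>n. a i \<noteq> None)"
  using wlength_word_of_seq[of "Suc n" a]
  by (simp add: Suc_ile_eq less_Suc_eq_le)

text \<open>All coordinates up to \<open>i\<close> must differ from \<open>None\<close>: an earlier
  \<open>None\<close> cuts the word off before position \<open>i\<close>, whatever
  \<open>a i\<close> is.\<close>

lemma letter_word_of_seq:
  assumes "\<forall>j\<le>i. a j \<noteq> None"
  shows "letter (word_of_seq a) i = the (a i)"
proof (cases a rule: sequence_cases)
  case infinite
  then show ?thesis
    by (simp add: word_of_seq_infinite)
next
  case (finite n)
  then have "i < n"
    using assms by (meson leI)
  moreover have "word_of_seq a = Fin_Word (map (\<lambda>i. the (a i)) [0..<n])"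
    by (rule word_of_seq_finite) fact+
  ultimately show ?thesis
    by simp
qed

lemma topspace_alphabet_sequences:
  "topspace (alphabet_sequences X) = {a. range a \<subseteq> insert None (Some ` topspace X)}"
  by (auto simp: alphabet_sequences_def PiE_UNIV_domain)

lemma word_of_seq_image: "word_of_seq ` topspace (alphabet_sequences X) = words X"
proof (intro subset_antisym subsetI)
  fix w assume "w \<in> word_of_seq ` topspace (alphabet_sequences X)"
  then obtain a where a: "range a \<subseteq> insert None (Some ` topspace X)" and w: "w = word_of_seq a"
    by (auto simp: topspace_alphabet_sequences)
  have letters: "the (a i) \<in> topspace X" if "a i \<noteq> None" for i
    using subsetD[OF a rangeI[of a i]] that by auto
  show "w \<in> words X"
  proof (cases a rule: sequence_cases)
    case infinite
    then show ?thesis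
      using letters by (auto simp: w words_def word_of_seq_infinite)
  next
    case (finite n)
    then have "word_of_seq a = Fin_Word (map (\<lambda>i. the (a i)) [0..<n])"
      by (rule word_of_seq_finite)
    then show ?thesis
      unfolding w words_def using finite(1) letters by (intro UnI1 image_eqI) auto
  qed
next
  fix w assume "w \<in> words X"
  then consider xs where "w = Fin_Word xs" "set xs \<subseteq> topspace X"
    | f where "w = Inf_Word f" "range f \<subseteq> topspace X"
    by (auto simp: words_def)
  then show "w \<in> word_of_seq ` topspace (alphabet_sequences X)"
  proof cases
    case 1
    \<comment> \<open>Only the first \<open>None\<close> matters, so the tail is arbitrary; padding
      with \<open>None\<close> keeps the sequence in the product.\<close>
    let ?a = "\<lambda>i. if i < length xs then Some (xs ! i) else None"
    have "word_of_seq ?a = w"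
      using 1 by (subst word_of_seq_finite[of "length xs"]) (auto intro: nth_equalityI)
    moreover have "?a \<in> topspace (alphabet_sequences X)"
      using 1 nth_mem by (auto simp: topspace_alphabet_sequences intro!: imageI)
    ultimately show ?thesis
      by blast
  next
    case 2
    then have "word_of_seq (\<lambda>i. Some (f i)) = w"
      "(\<lambda>i. Some (f i)) \<in> topspace (alphabet_sequences X)"
      by (auto simp: word_of_seq_infinite topspace_alphabet_sequences)
    then show ?thesis
      by blast
  qed
qed

section \<open>Cylinders are open in the quotient topology\<close>

text \<open>\<open>None\<close> lies in no image under \<open>Some\<close>. Hence the conditions on
  the first \<open>length Bs\<close> coordinates already force the word to be long enough, and a
  word that ends there meets the condition on \<open>K\<close> automatically.\<close>

lemma word_of_seq_in_cylinder_iff: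
  assumes "a \<in> topspace (alphabet_sequences X)"
  shows "word_of_seq a \<in> cylinder X Bs K \<longleftrightarrow>
    (\<forall>i<length Bs. a i \<in> Some ` (Bs ! i)) \<and> a (length Bs) \<notin> Some ` K"
proof (cases "\<forall>i<length Bs. a i \<noteq> None")
  case True
  have "letter (word_of_seq a) i \<in> B \<longleftrightarrow> a i \<in> Some ` B" if "i < length Bs" for i B
  proof -
    have "letter (word_of_seq a) i = the (a i)"
      using True that by (intro letter_word_of_seq) simp
    then show ?thesis
      using True that by force
  qed
  then have "(\<forall>i<length Bs. letter (word_of_seq a) i \<in> Bs ! i) \<longleftrightarrow>
      (\<forall>i<length Bs. a i \<in> Some ` (Bs ! i))"
    by blast
  moreover have "(enat (length Bs) < wlength (word_of_seq a) \<longrightarrow>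
      letter (word_of_seq a) (length Bs) \<notin> K) \<longleftrightarrow> a (length Bs) \<notin> Some ` K"
  proof (cases "a (length Bs)")
    case None
    then show ?thesis
      by (auto simp: wlength_word_of_seq_less)
  next
    case (Some x)
    then have *: "\<forall>i\<le>length Bs. a i \<noteq> None"
      using True by (auto simp: le_less)
    show ?thesis
      using * Some letter_word_of_seq[OF *] by (auto simp: wlength_word_of_seq_less)
  qed
  moreover have "word_of_seq a \<in> words X"
    using assms word_of_seq_image by blast
  moreover have "enat (length Bs) \<le> wlength (word_of_seq a)"
    using True by (simp add: wlength_word_of_seq)
  ultimately show ?thesis
    unfolding cylinder_def by blast
next
  case False
  then obtain i where i: "i < length Bs" "a i = None"
    by blast
  then have "\<not> enat (length Bs) \<le> wlength (word_of_seq a)"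
    by (auto simp: wlength_word_of_seq simp del: not_None_eq)
  moreover have "a i \<notin> Some ` (Bs ! i)"
    using i by auto
  ultimately show ?thesis
    using i(1) by (auto simp: cylinder_def)
qed

text \<open>The sets $C[K]$ are the case of no prefix, so both families of generators can be treated
  at once.\<close>

lemma empty_cylinder_eq_cylinder: "empty_cylinder X K = cylinder X [] K"
proof -
  have "enat 0 < wlength w \<longleftrightarrow> w \<noteq> Fin_Word []" for w :: "'a fi_word"
    by (cases w) auto
  then show ?thesis
    by (auto simp: empty_cylinder_def cylinder_def zero_enat_def[symmetric])
qed

lemma generalized_cylinders_eq:
  "generalized_cylinders X \<B> =
    {cylinder X Bs K | Bs K. set Bs \<subseteq> \<B> \<and> compactin X K \<and> openin X K}"
proof -
  have "set [] \<subseteq> \<B>" by simp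
  then show ?thesis
    unfolding generalized_cylinders_def empty_cylinder_eq_cylinder by blast
qed

lemma openin_cylinder:
  assumes "Hausdorff_space X" "\<forall>B\<in>set Bs. openin X B" "compactin X K"
  shows "openin (quotient_topology (alphabet_sequences X) word_of_seq) (cylinder X Bs K)"
proof -
  let ?Y = "Alexandroff_compactification X"
  have proj: "continuous_map (alphabet_sequences X) ?Y (\<lambda>a. a i)" for i
    unfolding alphabet_sequences_def by (rule continuous_map_product_projection) simp
  have 1: "openin (alphabet_sequences X)
      {a \<in> topspace (alphabet_sequences X). a i \<in> Some ` (Bs ! i)}" if "i < length Bs" for i
    using that assms(2)
    by (intro openin_continuous_map_preimage[OF proj]) auto
  \<comment> \<open>In a Hausdorff space the compact set \<open>K\<close> is closed, so its copy is
    closed in the compactification and the complement is an open neighbourhood of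
    \<open>None\<close>.\<close>
  have K: "openin ?Y (topspace ?Y - Some ` K)"
    using assms(3) compactin_imp_closedin[OF assms(1,3)]
    by (intro openin_diff openin_topspace) simp
  have "openin (alphabet_sequences X)
      {a \<in> topspace (alphabet_sequences X). a (length Bs) \<in> topspace ?Y - Some ` K}"
    by (rule openin_continuous_map_preimage[OF proj K])
  \<comment> \<open>The factor \<open>topspace\<close> covers \<open>Bs = []\<close>, where the
    indexed intersection is all of \<open>UNIV\<close>.\<close>
  moreover have "openin (alphabet_sequences X)
     (topspace (alphabet_sequences X) \<inter>
      (\<Inter>i<length Bs. {a \<in> topspace (alphabet_sequences X). a i \<in> Some ` (Bs ! i)}))"
    using 1 by (intro openin_Int_Inter) auto
  moreover have "{a \<in> topspace (alphabet_sequences X). word_of_seq a \<in> cylinder X Bs K} =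
     (topspace (alphabet_sequences X) \<inter>
      (\<Inter>i<length Bs. {a \<in> topspace (alphabet_sequences X). a i \<in> Some ` (Bs ! i)})) \<inter>
      {a \<in> topspace (alphabet_sequences X). a (length Bs) \<in> topspace ?Y - Some ` K}"
    using continuous_map_image_subset_topspace[OF proj[of "length Bs"]]
    by (auto simp: word_of_seq_in_cylinder_iff)
  ultimately have "openin (alphabet_sequences X)
      {a \<in> topspace (alphabet_sequences X). word_of_seq a \<in> cylinder X Bs K}"
    by (simp only: openin_Int)
  moreover have "cylinder X Bs K \<subseteq> words X"
    by (auto simp: cylinder_def)
  ultimately show ?thesis
    by (simp add: openin_quotient_topology word_of_seq_image)
qed

section \<open>Boxes and tubes in a countable power\<close>

text \<open>The finite set of restricted coordinates is enlarged to an initial segment, because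
  cylinders restrict initial segments.\<close>

lemma open_box_product_topology:
  assumes "openin (product_topology (\<lambda>_::nat. Y) UNIV) W" "a \<in> W"
  obtains V n where "\<And>i. openin Y (V i)" "\<And>i. a i \<in> V i"
    "\<And>x. (\<And>i. x i \<in> topspace Y) \<Longrightarrow> (\<And>i. i < n \<Longrightarrow> x i \<in> V i) \<Longrightarrow> x \<in> W"
proof -
  obtain V where V: "finite {i. V i \<noteq> topspace Y}" "\<And>i. openin Y (V i)"
      "a \<in> Pi\<^sub>E UNIV V" "Pi\<^sub>E UNIV V \<subseteq> W"
    using assms by (auto simp: openin_product_topology_alt)
  obtain n where n: "{i. V i \<noteq> topspace Y} \<subseteq> {..<n}"
    using V(1) finite_nat_iff_bounded by blast
  show thesis
  proof
    show "a i \<in> V i" for i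
      using V(3) by auto
    fix x assume x: "\<And>i. x i \<in> topspace Y" "\<And>i. i < n \<Longrightarrow> x i \<in> V i"
    have "x i \<in> V i" for i
      using n x by (cases "i < n") auto
    then show "x \<in> W"
      using V(4) by auto
  qed (rule V(2))
qed

text \<open>The sequences with prescribed first \<open>n\<close> coordinates form a product of
  compact sets, compact by Tychonoff. Finitely many open boxes inside \<open>W\<close> cover it, and
  intersecting their sides at each \<open>i < n\<close> gives the tube.\<close>

lemma tube_product_topology:
  fixes Y :: "'a topology" and a :: "nat \<Rightarrow> 'a"
  assumes "compact_space Y" and W: "openin (product_topology (\<lambda>_. Y) UNIV) W"
    and a: "\<And>i. i < n \<Longrightarrow> a i \<in> topspace Y"
    and sub: "\<And>x. (\<And>i. x i \<in> topspace Y) \<Longrightarrow> (\<And>i. i < n \<Longrightarrow> x i = a i) \<Longrightarrow> x \<in> W"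
  obtains V where "\<And>i. i < n \<Longrightarrow> openin Y (V i)" "\<And>i. i < n \<Longrightarrow> a i \<in> V i"
    "\<And>x. (\<And>i. x i \<in> topspace Y) \<Longrightarrow> (\<And>i. i < n \<Longrightarrow> x i \<in> V i) \<Longrightarrow> x \<in> W"
proof -
  let ?P = "product_topology (\<lambda>_::nat. Y) UNIV"
  define S where "S = Pi\<^sub>E UNIV (\<lambda>i. if i < n then {a i} else topspace Y)"
  have S: "x \<in> S \<longleftrightarrow> (\<forall>i. x i \<in> topspace Y) \<and> (\<forall>i<n. x i = a i)" for x
    using a by (auto simp: S_def PiE_UNIV_domain Pi_iff split: if_splits)
  have "compactin ?P S"
    unfolding S_def compactin_PiE using assms(1) a by (auto simp: compact_space_def)
  define box where "box V = {x \<in> topspace ?P. \<forall>i. x i \<in> V i}" for V :: "nat \<Rightarrow> 'a set"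
  \<comment> \<open>The cover is indexed by families of sides instead of boxes, since the sides are
    intersected separately later.\<close>
  define \<V> where "\<V> = {V. (\<forall>i. openin Y (V i)) \<and> openin ?P (box V) \<and> box V \<subseteq> W}"
  have "S \<subseteq> \<Union>(box ` \<V>)"
  proof
    fix x assume "x \<in> S"
    then have "x \<in> W"
      using sub S by blast
    then obtain V where V: "finite {i. V i \<noteq> topspace Y}" "\<And>i. openin Y (V i)"
        "x \<in> Pi\<^sub>E UNIV V" "Pi\<^sub>E UNIV V \<subseteq> W"
      using W by (auto simp: openin_product_topology_alt)
    have box: "box V = Pi\<^sub>E UNIV V"
      using openin_subset[OF V(2)] by (auto simp: box_def)
    have "openin ?P (Pi\<^sub>E UNIV V)"
      using V by (auto simp: openin_PiE_gen)
    then have "V \<in> \<V>"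
      using V box by (auto simp: \<V>_def)
    then show "x \<in> \<Union>(box ` \<V>)"
      using V(3) box by blast
  qed
  moreover have "\<forall>U\<in>box ` \<V>. openin ?P U"
    by (auto simp: \<V>_def)
  ultimately obtain \<F> where "finite \<F>" "\<F> \<subseteq> box ` \<V>" "S \<subseteq> \<Union>\<F>"
    using \<open>compactin ?P S\<close> unfolding compactin_def by meson
  then obtain \<G> where \<G>: "finite \<G>" "\<G> \<subseteq> \<V>" "S \<subseteq> \<Union>(box ` \<G>)"
    by (metis finite_subset_image)
  \<comment> \<open>Sides that miss \<open>a i\<close> are dropped, since the chosen boxes need not
    all contain \<open>a i\<close> at \<open>i\<close>. The factor \<open>topspace Y\<close> handles
    an empty family.\<close>
  define V where "V i = topspace Y \<inter> \<Inter>{V i | V. V \<in> \<G> \<and> a i \<in> V i}" for i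
  show thesis
  proof
    fix i assume i: "i < n"
    show "a i \<in> V i"
      using a[OF i] by (auto simp: V_def)
    have "finite {V i | V. V \<in> \<G> \<and> a i \<in> V i}"
      using \<G>(1) by simp
    moreover have "\<And>U. U \<in> {V i | V. V \<in> \<G> \<and> a i \<in> V i} \<Longrightarrow> openin Y U"
      using \<G>(2) by (auto simp: \<V>_def)
    ultimately show "openin Y (V i)"
      unfolding V_def
      by (intro openin_Int_Inter openin_topspace)
  next
    fix x assume x: "\<And>i. x i \<in> topspace Y" "\<And>i. i < n \<Longrightarrow> x i \<in> V i"
    \<comment> \<open>Overwriting the start of \<open>x\<close> by \<open>a\<close> gives a point of
      \<open>S\<close>, hence of some chosen box. The sides of that box contain \<open>a i\<close>
      for \<open>i < n\<close>, so they were kept in \<open>V i\<close>; from \<open>n\<close> on,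
      \<open>x\<close> and \<open>y\<close> agree.\<close>
    define y where "y i = (if i < n then a i else x i)" for i
    have "y \<in> S"
      using x a by (auto simp: S y_def)
    then obtain U where U: "U \<in> \<G>" "y \<in> box U"
      using \<G>(3) by blast
    have "x i \<in> U i" for i
    proof (cases "i < n")
      case True
      then have "a i \<in> U i"
        using U(2) by (auto simp: box_def y_def dest: spec[of _ i])
      then show ?thesis
        using x(2)[OF True] U(1) by (auto simp: V_def)
    next
      case False
      then show ?thesis
        using U(2) by (auto simp: box_def y_def dest: spec[of _ i])
    qed
    then have "x \<in> box U"
      using x(1) by (auto simp: box_def)
    then show "x \<in> W"
      using U(1) \<G>(2) by (auto simp: \<V>_def)
  qed
qed

section \<open>Refinement by compact open sets\<close>

lemma basis_box:
  assumes basis: "\<forall>U. openin X U \<longrightarrow> (\<exists>\<U>\<subseteq>\<B>. \<Union>\<U> = U)"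
    and V: "\<And>i. i < n \<Longrightarrow> openin (Alexandroff_compactification X) (V i)"
    and a: "\<And>i. i < n \<Longrightarrow> a i \<in> V i" "\<And>i. i < n \<Longrightarrow> a i \<noteq> None"
  obtains Bs where "length Bs = n" "set Bs \<subseteq> \<B>"
    "\<And>i. i < n \<Longrightarrow> a i \<in> Some ` (Bs ! i)" "\<And>i. i < n \<Longrightarrow> Some ` (Bs ! i) \<subseteq> V i"
proof -
  have "\<exists>B\<in>\<B>. a i \<in> Some ` B \<and> Some ` B \<subseteq> V i" if i: "i < n" for i
  proof -
    obtain x where x: "a i = Some x"
      using a(2)[OF i] by blast
    obtain U where U: "openin X U" "Some ` U \<subseteq> V i" "x \<in> U"
    proof -
      \<comment> \<open>Both kinds of open sets of the compactification have an open trace on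
        \<open>X\<close>; for a neighbourhood of \<open>None\<close> it is
        \<open>topspace X - C\<close>.\<close>
      from V[OF i] consider U where "openin X U" "V i = Some ` U"
        | C where "closedin X C" "V i = insert None (Some ` (topspace X - C))"
        by (auto simp: openin_Alexandroff_compactification)
      then show thesis
        using a(1)[OF i] x that by cases auto
    qed
    then obtain B where "B \<in> \<B>" "x \<in> B" "B \<subseteq> U"
      using basis by (metis Union_iff Union_upper subsetD)
    then show ?thesis
      using U x by blast
  qed
  then obtain f where f: "\<And>i. i < n \<Longrightarrow> f i \<in> \<B> \<and> a i \<in> Some ` f i \<and> Some ` f i \<subseteq> V i"
    by metis
  show thesis
    by (rule that[of "map f [0..<n]"]) (use f in auto)
qed

text \<open>Finitely many basis sets cover \<open>C\<close>, and their union is again compact and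
  open.\<close>

lemma compact_open_superset:
  assumes basis: "\<forall>U. openin X U \<longrightarrow> (\<exists>\<U>\<subseteq>\<B>. \<Union>\<U> = U)"
    and \<B>: "\<forall>B\<in>\<B>. openin X B \<and> compactin X B" and C: "compactin X C"
  obtains K where "compactin X K" "openin X K" "C \<subseteq> K"
proof -
  obtain \<U> where \<U>: "\<U> \<subseteq> \<B>" "\<Union>\<U> = topspace X"
    using basis by (meson openin_topspace)
  then have "\<forall>U\<in>\<U>. openin X U" "C \<subseteq> \<Union>\<U>"
    using \<B> compactin_subset_topspace[OF C] by auto
  then obtain \<F> where \<F>: "finite \<F>" "\<F> \<subseteq> \<U>" "C \<subseteq> \<Union>\<F>"
    using C unfolding compactin_def by meson
  show thesis
  proof
    show "compactin X (\<Union>\<F>)"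
      using \<F> \<U> \<B> by (intro compactin_Union) auto
    show "openin X (\<Union>\<F>)"
      using \<F> \<U> \<B> by (intro openin_Union) auto
  qed fact
qed

section \<open>Quotient-open sets are unions of cylinders\<close>

lemma cylinder_neighbourhood:
  assumes basis: "\<forall>U. openin X U \<longrightarrow> (\<exists>\<U>\<subseteq>\<B>. \<Union>\<U> = U)"
    and \<B>: "\<forall>B\<in>\<B>. openin X B \<and> compactin X B"
    and U: "openin (quotient_topology (alphabet_sequences X) word_of_seq) U" and w: "w \<in> U"
  obtains Bs K where "set Bs \<subseteq> \<B>" "compactin X K" "openin X K"
    "w \<in> cylinder X Bs K" "cylinder X Bs K \<subseteq> U"
proof -
  let ?Y = "Alexandroff_compactification X"
  define W where "W = {a \<in> topspace (alphabet_sequences X). word_of_seq a \<in> U}"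
  have U': "U \<subseteq> words X" and W: "openin (product_topology (\<lambda>_. ?Y) UNIV) W"
    using U unfolding openin_quotient_topology word_of_seq_image W_def
    by (auto simp: alphabet_sequences_def)
  have top: "x \<in> topspace (alphabet_sequences X) \<longleftrightarrow> (\<forall>i. x i \<in> topspace ?Y)" for x
    by (auto simp: topspace_alphabet_sequences)
  obtain a where a: "a \<in> topspace (alphabet_sequences X)" "w = word_of_seq a"
    using w U' word_of_seq_image[of X] by blast
  then have aW: "a \<in> W"
    using w by (simp add: W_def)
  \<comment> \<open>Inclusion of the cylinder in \<open>U\<close> is tested on sequences; this
    suffices because \<open>word_of_seq\<close> is onto \<open>words X\<close>.\<close>
  have "\<exists>Bs K. set Bs \<subseteq> \<B> \<and> compactin X K \<and> openin X K \<and> w \<in> cylinder X Bs K \<and>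
    (\<forall>b\<in>topspace (alphabet_sequences X). word_of_seq b \<in> cylinder X Bs K \<longrightarrow> b \<in> W)"
  proof (cases a rule: sequence_cases)
    case infinite
    obtain V n where V: "\<And>i. openin ?Y (V i)" "\<And>i. a i \<in> V i"
      "\<And>x. (\<And>i. x i \<in> topspace ?Y) \<Longrightarrow> (\<And>i. i < n \<Longrightarrow> x i \<in> V i) \<Longrightarrow> x \<in> W"
      by (rule open_box_product_topology[OF W aW]) blast
    obtain Bs where Bs: "length Bs = n" "set Bs \<subseteq> \<B>"
      "\<And>i. i < n \<Longrightarrow> a i \<in> Some ` (Bs ! i)" "\<And>i. i < n \<Longrightarrow> Some ` (Bs ! i) \<subseteq> V i"
      using basis_box[OF basis, of n V a] V infinite by metis
    \<comment> \<open>The box restricts only coordinates below \<open>n\<close>, so coordinate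
      \<open>n\<close> must stay free: \<open>K = {}\<close>.\<close>
    have "w \<in> cylinder X Bs {}"
      using Bs a by (simp add: word_of_seq_in_cylinder_iff)
    moreover have "b \<in> W"
      if b: "b \<in> topspace (alphabet_sequences X)" "word_of_seq b \<in> cylinder X Bs {}" for b
    proof (rule V(3))
      show "b i \<in> topspace ?Y" for i
        using b top by blast
      show "b i \<in> V i" if "i < n" for i
        using b Bs that by (auto simp: word_of_seq_in_cylinder_iff dest!: subsetD)
    qed
    ultimately show ?thesis
      using Bs(2) by (intro exI[of _ Bs] exI[of _ "{}"]) auto
  next
    case (finite n)
    \<comment> \<open>\<open>Suc n\<close> coordinates are fixed: the \<open>n\<close> letters and
      the \<open>None\<close> at position \<open>n\<close> that ends the word. Everything beyond
      leaves the word unchanged.\<close>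
    have sub: "x \<in> W" if "\<And>i. x i \<in> topspace ?Y" "\<And>i. i < Suc n \<Longrightarrow> x i = a i" for x
    proof -
      have "word_of_seq x = word_of_seq a"
        using finite that(2) by (simp add: word_of_seq_finite[of n])
      then show ?thesis
        using that(1) a w by (simp add: W_def top)
    qed
    have aY: "a i \<in> topspace ?Y" for i
      using a top by blast
    obtain V where V: "\<And>i. i < Suc n \<Longrightarrow> openin ?Y (V i)"
      "\<And>i. i < Suc n \<Longrightarrow> a i \<in> V i"
      "\<And>x. (\<And>i. x i \<in> topspace ?Y) \<Longrightarrow> (\<And>i. i < Suc n \<Longrightarrow> x i \<in> V i) \<Longrightarrow> x \<in> W"
    proof (rule tube_product_topology[OF compact_space_Alexandroff_compactification W])
      show "a i \<in> topspace ?Y" for i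
        by (rule aY)
      show "x \<in> W" if "\<And>i. x i \<in> topspace ?Y" "\<And>i. i < Suc n \<Longrightarrow> x i = a i" for x
        using that by (rule sub)
    qed blast
    obtain Bs where Bs: "length Bs = n" "set Bs \<subseteq> \<B>"
      "\<And>i. i < n \<Longrightarrow> a i \<in> Some ` (Bs ! i)" "\<And>i. i < n \<Longrightarrow> Some ` (Bs ! i) \<subseteq> V i"
      using basis_box[OF basis, of n V a] V finite by (metis less_Suc_eq)
    \<comment> \<open>\<open>V n\<close> contains \<open>a n = None\<close>, so it is an open set of
      the second kind, the complement of a compact set of letters.\<close>
    obtain C where C: "compactin X C" "V n = insert None (Some ` (topspace X - C))"
      using V(1,2)[of n] finite(2) by (auto simp: openin_Alexandroff_compactification)
    obtain K where K: "compactin X K" "openin X K" "C \<subseteq> K"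
      by (rule compact_open_superset[OF basis \<B> C(1)])
    have "w \<in> cylinder X Bs K"
      using Bs a finite(2) by (simp add: word_of_seq_in_cylinder_iff)
    moreover have "b \<in> W"
      if b: "b \<in> topspace (alphabet_sequences X)" "word_of_seq b \<in> cylinder X Bs K" for b
    proof (rule V(3))
      show bY: "b i \<in> topspace ?Y" for i
        using b top by blast
      \<comment> \<open>Either \<open>b n\<close> is \<open>None\<close> or it is a letter outside
        \<open>K\<close>, hence outside \<open>C\<close>.\<close>
      have "b n \<in> V n"
        using bY[of n] b Bs(1) K(3) C(2)
        by (cases "b n") (auto simp: word_of_seq_in_cylinder_iff)
      moreover have "b i \<in> V i" if "i < n" for i
        using b Bs(1) Bs(4)[OF that] that by (auto simp: word_of_seq_in_cylinder_iff)
      ultimately show "b i \<in> V i" if "i < Suc n" for i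
        using that by (auto simp: less_Suc_eq)
    qed
    ultimately show ?thesis
      using Bs(2) K by blast
  qed
  then obtain Bs K where BK: "set Bs \<subseteq> \<B>" "compactin X K" "openin X K" "w \<in> cylinder X Bs K"
    "\<forall>b\<in>topspace (alphabet_sequences X). word_of_seq b \<in> cylinder X Bs K \<longrightarrow> b \<in> W"
    by blast
  have "cylinder X Bs K \<subseteq> word_of_seq ` topspace (alphabet_sequences X)"
    by (auto simp: word_of_seq_image cylinder_def)
  then have "cylinder X Bs K \<subseteq> U"
    using BK(5) by (auto simp: W_def)
  then show thesis
    using that BK by blast
qed

section \<open>Comparison of the two topologies\<close>

theorem proposition2p7:
  fixes X :: "'a topology" and \<B> :: "'a set set"
  assumes "infinite (topspace X)"
    and "locally_compact_space X"
    and "Hausdorff_space X"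
    and "countable \<B>"
    and "\<forall>B\<in>\<B>. openin X B \<and> compactin X B"
    and "\<forall>U. openin X U \<longrightarrow> (\<exists>\<U>\<subseteq>\<B>. \<Union>\<U> = U)"
    and "\<forall>B\<in>\<B>. \<forall>B'\<in>\<B>. B \<inter> B' \<in> \<B>"
  shows "word_of_seq ` topspace (alphabet_sequences X) = words X \<and>
         generalized_cylinder_topology X \<B> = quotient_topology (alphabet_sequences X) word_of_seq"
proof
  show "word_of_seq ` topspace (alphabet_sequences X) = words X"
    by (rule word_of_seq_image)
  let ?Q = "quotient_topology (alphabet_sequences X) word_of_seq"
  show "generalized_cylinder_topology X \<B> = ?Q"
    unfolding topology_eq
  proof (intro allI iffI)
    fix U
    assume "openin (generalized_cylinder_topology X \<B>) U"
    then have "generate_topology_on (generalized_cylinders X \<B>) U"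
      by (simp add: generalized_cylinder_topology_def openin_topology_generated_by_iff)
    moreover have "openin ?Q S" if "S \<in> generalized_cylinders X \<B>" for S
      using that assms(3,5) by (force simp: generalized_cylinders_eq intro!: openin_cylinder)
    ultimately show "openin ?Q U"
      by (induction rule: generate_topology_on.induct) auto
  next
    fix U
    assume U: "openin ?Q U"
    show "openin (generalized_cylinder_topology X \<B>) U"
      unfolding openin_subopen[of _ U]
    proof
      fix w assume "w \<in> U"
      then obtain Bs K where "set Bs \<subseteq> \<B>" "compactin X K" "openin X K"
        "w \<in> cylinder X Bs K" "cylinder X Bs K \<subseteq> U"
        by (rule cylinder_neighbourhood[OF assms(6,5) U])
      \<comment> \<open>For \<open>Bs = []\<close>, the case of the empty prefix, this cylinder is
        an \<open>empty_cylinder\<close> and so still a generator.\<close>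
      moreover from this have "openin (generalized_cylinder_topology X \<B>) (cylinder X Bs K)"
        unfolding generalized_cylinder_topology_def generalized_cylinders_eq
        by (intro topology_generated_by_Basis) blast
      ultimately show "\<exists>T. openin (generalized_cylinder_topology X \<B>) T \<and> w \<in> T \<and> T \<subseteq> U"
        by blast
    qed
  qed
qed

end
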